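(* Let $\lambda$ be an infinite cardinal, let $p:[\lambda^+]^2\to\lambda$ be a partition, and let $\chi\le\operatorname{cf}(\lambda)$ be a cardinal. Then $\mathrm{pr}_1(\lambda^+,\lambda^+,\lambda,\chi)_p$ holds if and only if $\mathrm{pr}_1(\lambda^+,\lambda^+,\lambda^+,\chi)_p$ holds.
   Context: $[\kappa]^2$ denotes the set of pairs $(\alpha,\beta)$ with $\alpha<\beta<\kappa$; a partition is any function $p:[\kappa]^2\to\mu$. For an ordinal $\sigma$, $[\kappa]^\sigma$ is the set of subsets of $\kappa$ of order type $\sigma$. For sets of ordinals $a,b$, $a<b$ means $\alpha<\beta$ for all $\alpha\in a,\beta\in b$. Given a partition $p:[\kappa]^2\to\mu$, a coloring $c:[\kappa]^2\to\theta$ witnesses $\mathrm{pr}_1(\kappa,\kappa,\theta,\chi)_p$ iff for every ordinal $\sigma<\chi$, every pairwise disjoint family $\mathcal A\subseteq[\kappa]^\sigma$ with $|\mathcal A|=\kappa$, and every function $\tau:\mu\to\theta$, there are $a,b\in\mathcal A$ with $a<b$ such that $c(\alpha,\beta)=\tau(p(\alpha,\beta))$ for all $\alpha\in a$ and $\beta\in b$. The principle $\mathrm{pr}_1(\kappa,\kappa,\theta,\chi)_p$ asserts that such a coloring exists. *)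

theory Defs
  imports Main
begin

text \<open>Cardinals and ordinals are represented by well-order relations (BNF cardinal library in Main).
A cardinal kappa is a relation with Card_order kappa; the ordinals below kappa are the elements of
Field kappa, ordered strictly by rlt kappa.\<close>

definition rlt :: "'a rel \<Rightarrow> 'a \<Rightarrow> 'a \<Rightarrow> bool" where
  "rlt r x y \<longleftrightarrow> (x, y) \<in> r \<and> x \<noteq> y"

definition set_lt :: "'a rel \<Rightarrow> 'a set \<Rightarrow> 'a set \<Rightarrow> bool" where
  "set_lt r a b \<longleftrightarrow> (\<forall>x\<in>a. \<forall>y\<in>b. rlt r x y)"

definition is_pair_fun :: "'a rel \<Rightarrow> 'm set \<Rightarrow> ('a \<Rightarrow> 'a \<Rightarrow> 'm) \<Rightarrow> bool" where
  "is_pair_fun kappa M f \<longleftrightarrow>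
     (\<forall>x\<in>Field kappa. \<forall>y\<in>Field kappa. rlt kappa x y \<longrightarrow> f x y \<in> M)"

definition cofinal :: "'a rel \<Rightarrow> 'a set \<Rightarrow> bool" where
  "cofinal r A \<longleftrightarrow> A \<subseteq> Field r \<and> (\<forall>x\<in>Field r. \<exists>y\<in>A. (x, y) \<in> r)"

definition le_cf :: "'c rel \<Rightarrow> 'a rel \<Rightarrow> bool" where
  "le_cf chi lam \<longleftrightarrow> (\<forall>A. cofinal lam A \<longrightarrow> (chi, card_of A) \<in> ordLeq)"

text \<open>c witnesses pr_1(kappa,kappa,theta,chi)_p, where p : [kappa]^2 -> mu.
Ordinals sigma < chi are represented by well-orders on (subsets of) the type of chi;
a set a \<subseteq> kappa has order type sigma iff (Restr kappa a, sigma) \<in> ordIso.\<close>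
definition pr1_wit :: "'b rel \<Rightarrow> 't rel \<Rightarrow> 'c rel \<Rightarrow> 'm rel \<Rightarrow> ('b \<Rightarrow> 'b \<Rightarrow> 'm)
    \<Rightarrow> ('b \<Rightarrow> 'b \<Rightarrow> 't) \<Rightarrow> bool" where
  "pr1_wit kappa theta chi mu p c \<longleftrightarrow>
     is_pair_fun kappa (Field theta) c \<and>
     (\<forall>sigma :: 'c rel. Well_order sigma \<and> (sigma, chi) \<in> ordLess \<longrightarrow>
       (\<forall>\<A> :: 'b set set.
          (\<forall>a\<in>\<A>. a \<subseteq> Field kappa \<and> (Restr kappa a, sigma) \<in> ordIso) \<and>
          pairwise disjnt \<A> \<and> (card_of \<A>, kappa) \<in> ordIso \<longrightarrow>
          (\<forall>\<tau> :: 'm \<Rightarrow> 't. (\<forall>i\<in>Field mu. \<tau> i \<in> Field theta) \<longrightarrow>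
             (\<exists>a\<in>\<A>. \<exists>b\<in>\<A>. set_lt kappa a b \<and>
                (\<forall>x\<in>a. \<forall>y\<in>b. c x y = \<tau> (p x y))))))"

definition pr1 :: "'b rel \<Rightarrow> 't rel \<Rightarrow> 'c rel \<Rightarrow> 'm rel \<Rightarrow> ('b \<Rightarrow> 'b \<Rightarrow> 'm) \<Rightarrow> bool" where
  "pr1 kappa theta chi mu p \<longleftrightarrow> (\<exists>c. pr1_wit kappa theta chi mu p c)"

end

theory Submission
  imports Defs
begin

text \<open>
Fewer colours are obtained by composing with an injection of \<open>\<lambda>\<close> into \<open>\<lambda>\<^sup>+\<close>. For the converse fix
enumerations \<open>e\<^sub>z\<close> of \<open>z < \<lambda>\<^sup>+\<close> in type \<open>\<lambda>\<close>. A function \<open>\<tau> : \<lambda> \<rightarrow> \<lambda>\<^sup>+\<close> is bounded by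
some \<open>D < \<lambda>\<^sup>+\<close>, so it is enough to find \<open>H(\<alpha>, \<beta>, i)\<close> with \<open>i < \<lambda>\<close> such that every family of blocks
has a large subfamily on which one \<open>i\<close> yields \<open>H(\<alpha>, \<beta>, i) = D\<close> for all \<open>\<alpha> \<in> a\<close>, \<open>\<beta> \<in> b\<close>, \<open>a < b\<close>: if the
old colour of \<open>(\<alpha>, \<beta>)\<close> codes \<open>(i, j)\<close>, the new one is \<open>e\<^bsub>H(\<alpha>, \<beta>, i)\<^esub>(j)\<close>.

If \<open>cf \<lambda> = \<omega>\<close>, blocks are finite, and \<open>i\<close> codes a finite set separating the members of a block,
viewed as distinct subsets of \<open>\<lambda>\<close>, together with the index of \<open>D\<close> in the enumeration of each of them.

If \<open>cf \<lambda> > \<omega>\<close>, attach to \<open>\<beta>\<close> and \<open>i\<close> a hull of at most \<open>|i|\<close> ordinals below \<open>\<beta>\<close>, closed under taking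
a cofinal subset of each member of cofinality at most \<open>|i|\<close> and under escaping from finitely many
clubs. A point \<open>x\<close> of cofinality above \<open>|i|\<close> is isolated from below in each hull containing it.
For a good choice of the finitely many clubs, such points lie in every further club and in
the hulls of all members of a block simultaneously (this uses that blocks are shorter than \<open>cf \<lambda>\<close>).
Pressing down gives one \<open>\<epsilon>\<close> such that, for unboundedly many \<open>x\<close> with a block \<open>b\<close> above it, the hulls
of the members of \<open>b\<close> have no point strictly between \<open>\<epsilon>\<close> and \<open>x\<close>. After thinning out the blocks, \<open>x\<close> is the
first member of the hull of \<open>\<beta>\<close> above \<open>\<alpha>\<close>, whatever \<open>\<alpha> \<in> a\<close> and \<open>\<beta> \<in> b\<close>; and \<open>j\<^sub>0\<close> with
\<open>e\<^sub>x(j\<^sub>0) = D\<close> is constant on a large subfamily.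
\<close>

unbundle cardinal_syntax

section \<open>Well-orders and cardinal arithmetic\<close>

lemma rlt_linear:
  assumes "Well_order r" "x \<in> Field r" "y \<in> Field r"
  shows "rlt r x y \<or> x = y \<or> rlt r y x"
  using assms unfolding rlt_def well_order_on_def linear_order_on_def total_on_def by blast

lemma rlt_trans:
  assumes "Well_order r" "rlt r x y" "rlt r y z"
  shows "rlt r x z"
  using assms unfolding rlt_def well_order_on_def linear_order_on_def partial_order_on_def
    preorder_on_def trans_def antisym_def by metis

lemma rlt_asym:
  assumes "Well_order r" "rlt r x y"
  shows "\<not> rlt r y x"
  using assms unfolding rlt_def well_order_on_def linear_order_on_def partial_order_on_def
    antisym_def by metis

lemma rlt_irrefl [simp]: "\<not> rlt r x x"
  by (simp add: rlt_def)

lemma rlt_Field: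
  assumes "rlt r x y"
  shows "x \<in> Field r" "y \<in> Field r"
  using assms unfolding rlt_def Field_def by blast+

lemma underS_rlt: "underS r z = {x. rlt r x z}"
  unfolding underS_def rlt_def by blast

lemma in_iff_not_rlt:
  assumes "Well_order r" "x \<in> Field r" "y \<in> Field r"
  shows "(x, y) \<in> r \<longleftrightarrow> \<not> rlt r y x"
proof -
  have "(x, x) \<in> r"
    using assms unfolding well_order_on_def linear_order_on_def partial_order_on_def
      preorder_on_def refl_on_def by blast
  then show ?thesis
    using rlt_linear[OF assms] rlt_asym[OF assms(1)] unfolding rlt_def by blast
qed

lemma cofinal_Field:
  assumes "Well_order r"
  shows "cofinal r (Field r)"
proof -
  have "(x, x) \<in> r" if "x \<in> Field r" for x
    using in_iff_not_rlt[OF assms that that] by simp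
  then show ?thesis unfolding cofinal_def by blast
qed

lemma rlt_least:
  assumes "Well_order r" "S \<subseteq> Field r" "S \<noteq> {}"
  shows "\<exists>m\<in>S. \<forall>z\<in>S. \<not> rlt r z m"
proof -
  have "wf (r - Id)"
    using assms(1) by (simp add: well_order_on_def)
  then obtain m where "m \<in> S" "\<And>z. (z, m) \<in> r - Id \<Longrightarrow> z \<notin> S"
    using assms(3) by (metis wfE_min ex_in_conv)
  then show ?thesis
    unfolding rlt_def by blast
qed

lemma not_cofinal_bound:
  assumes "Well_order r" "X \<subseteq> Field r" "\<not> cofinal r X"
  shows "\<exists>i\<in>Field r. \<forall>x\<in>X. rlt r x i"
proof -
  obtain i where i: "i \<in> Field r" "\<forall>y\<in>X. (i, y) \<notin> r"
    using assms unfolding cofinal_def by blast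
  then have "rlt r x i" if "x \<in> X" for x
    using in_iff_not_rlt[OF assms(1) i(1), of x] assms(2) that by blast
  then show ?thesis
    using i by blast
qed

lemma ordLess_card_underS:
  assumes "Card_order r" "|X| <o r"
  obtains i where "i \<in> Field r" "|X| \<le>o |underS r i|"
proof -
  have wo: "Well_order r" using assms(1) by (simp add: card_order_on_def)
  then obtain i where i: "i \<in> Field r" "|X| =o Restr r (underS r i)"
    using assms(2) ordLess_iff_ordIso_Restr[OF wo card_of_Well_order] by blast
  have "Field (Restr r (underS r i)) = underS r i"
    by (rule Field_Restr_ofilter[OF wo]) (simp add: wo wo_rel.underS_ofilter wo_rel_def)
  then have "|X| =o |underS r i|"
    by (metis i(2) card_of_cong card_of_Field_ordIso card_of_Card_order Field_card_of)
  then show thesis using that i ordIso_imp_ordLeq by blast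
qed

lemma card_of_nat_UNION_ordLeq:
  fixes X :: "nat \<Rightarrow> 'a set"
  assumes "\<not> finite B" "\<And>n. |X n| \<le>o |B|"
  shows "|\<Union>n. X n| \<le>o |B|"
  by (rule card_of_UNION_ordLeq_infinite) (use assms infinite_iff_card_of_nat in auto)

text \<open>The closure is a union of countably many levels, each obtained from the one before by a
  union of at most |B| sets no larger than \<open>B\<close>.\<close>

lemma card_of_rtrancl_Image_ordLeq:
  assumes "\<not> finite B" "\<And>z. |R `` {z}| \<le>o |B|"
  shows "|R\<^sup>* `` {d}| \<le>o |B|"
proof -
  have "|(R ^^ n) `` {d}| \<le>o |B|" for n
  proof (induction n)
    case 0
    then show ?case
      using card_of_singl_ordLeq[of B d] assms(1) by auto
  next
    case (Suc n)
    have "(R ^^ Suc n) `` {d} = (\<Union>z\<in>(R ^^ n) `` {d}. R `` {z})"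
      by auto
    then show ?case
      using card_of_UNION_ordLeq_infinite[OF assms(1) Suc] assms(2) by metis
  qed
  then have "|\<Union>n. (R ^^ n) `` {d}| \<le>o |B|"
    by (rule card_of_nat_UNION_ordLeq[OF assms(1)])
  moreover have "R\<^sup>* `` {d} = (\<Union>n. (R ^^ n) `` {d})"
    by (auto simp: rtrancl_is_UN_relpow)
  ultimately show ?thesis by simp
qed

text \<open>Induction on the size: a set of n + 1 elements is one of n elements with a point of
  \<open>A\<close> inserted. Then all sizes are united.\<close>

lemma card_of_Fpow_ordLeq:
  assumes "\<not> finite B"  "|A| \<le>o |B|"
  shows "|Fpow A| \<le>o |B|"
proof -
  let ?F = "\<lambda>n. {X. X \<subseteq> A \<and> finite X \<and> card X = n}"
  have "|?F n| \<le>o |B|" for n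
  proof (induction n)
    case 0
    have "?F 0 = {{}}" by auto
    then show ?case
      using card_of_singl_ordLeq[of B "{}"] assms(1) by (metis finite.emptyI)
  next
    case (Suc n)
    have "?F (Suc n) \<subseteq> (\<Union>a\<in>A. insert a ` ?F n)"
    proof
      fix X assume "X \<in> ?F (Suc n)"
      then obtain a Y where "X = insert a Y" "a \<notin> Y" "card Y = n" "finite Y" "X \<subseteq> A"
        by (auto simp: card_Suc_eq)
      then show "X \<in> (\<Union>a\<in>A. insert a ` ?F n)" by blast
    qed
    moreover have "|\<Union>a\<in>A. insert a ` ?F n| \<le>o |B|"
      by (rule card_of_UNION_ordLeq_infinite[OF assms])
        (auto intro: ordLeq_transitive[OF card_of_image Suc])
    ultimately show ?case
      by (meson card_of_mono1 ordLeq_transitive)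
  qed
  then have "|\<Union>n. ?F n| \<le>o |B|"
    by (rule card_of_nat_UNION_ordLeq[OF assms(1)])
  moreover have "Fpow A = (\<Union>n. ?F n)"
    by (auto simp: Fpow_def)
  ultimately show ?thesis by simp
qed

text \<open>One point of the symmetric difference for each of the finitely many pairs
  suffices.\<close>

lemma finite_separating_set:
  assumes "finite b" "inj_on s b"
  obtains F where "finite F" "F \<subseteq> \<Union> (s ` b)" "inj_on (\<lambda>x. s x \<inter> F) b"
proof -
  define d where "d = (\<lambda>(x, y). SOME z. z \<in> (s x - s y) \<union> (s y - s x))"
  define F where "F = d ` {(x, y). x \<in> b \<and> y \<in> b \<and> x \<noteq> y}"
  have d: "d (x, y) \<in> (s x - s y) \<union> (s y - s x)" if "x \<in> b" "y \<in> b" "x \<noteq> y" for x y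
  proof -
    have "s x \<noteq> s y" using assms(2) that by (auto simp: inj_on_def)
    then have "\<exists>z. z \<in> (s x - s y) \<union> (s y - s x)" by blast
    then show ?thesis unfolding d_def prod.case by (rule someI_ex)
  qed
  have "{(x, y). x \<in> b \<and> y \<in> b \<and> x \<noteq> y} \<subseteq> b \<times> b" by auto
  then have "finite F"
    unfolding F_def by (meson assms(1) finite_SigmaI finite_imageI finite_subset)
  moreover have "F \<subseteq> \<Union> (s ` b)"
    unfolding F_def using d by fastforce
  moreover have "inj_on (\<lambda>x. s x \<inter> F) b"
  proof (rule inj_onI, rule ccontr)
    fix x y assume *: "x \<in> b" "y \<in> b" "s x \<inter> F = s y \<inter> F" "x \<noteq> y"
    then have "d (x, y) \<in> F" unfolding F_def by blast
    then show False using d[OF *(1,2,4)] * by blast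
  qed
  ultimately show thesis using that by blast
qed

section \<open>Regularity of \<open>kappa\<close>, unbounded families and clubs\<close>

locale succ_card =
  fixes lam :: "'a rel" and kappa :: "'b rel"
  assumes lam: "Card_order lam" and infinite_lam: "\<not> finite (Field lam)"
    and kappa: "Card_order kappa" and kappa_succ: "kappa =o cardSuc lam"
begin

abbreviation lt (infix "\<prec>" 50) where "lt \<equiv> rlt kappa"

lemma wo_kappa: "Well_order kappa" and wo_lam: "Well_order lam"
  using kappa lam by (simp_all add: card_order_on_def)

lemmas lt_trans = rlt_trans[OF wo_kappa]
  and lt_asym = rlt_asym[OF wo_kappa]
  and lt_linear = rlt_linear[OF wo_kappa]
  and lt_least = rlt_least[OF wo_kappa]
  and lt_Field = rlt_Field[of kappa]

lemma le_lt_trans: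
  assumes "\<not> y \<prec> x" "x \<in> Field kappa" "y \<prec> z"
  shows "x \<prec> z"
  using lt_linear[OF assms(2) lt_Field(1)[OF assms(3)]] lt_trans[of x y z] assms by blast

lemma ordLeq_lam_iff: "|X| \<le>o lam \<longleftrightarrow> |X| <o kappa"
proof -
  have "|X| <o cardSuc lam \<longleftrightarrow> |X| <o kappa"
    using kappa_succ ordIso_symmetric ordLess_ordIso_trans by metis
  then show ?thesis
    using cardSuc_ordLeq_ordLess[OF lam card_of_Card_order[of X]] by simp
qed

lemma lam_Field: "|Field lam| \<le>o lam"
  by (rule ordIso_imp_ordLeq[OF card_of_Field_ordIso[OF lam]])

lemma UNION_le_lam:
  assumes "|I| \<le>o lam" "\<And>i. i \<in> I \<Longrightarrow> |X i| \<le>o lam"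
  shows "|\<Union>i\<in>I. X i| \<le>o lam"
  by (rule card_of_UNION_ordLeq_infinite_Field[OF infinite_lam lam assms(1)])
    (use assms(2) in simp)

lemma below_le_lam: "|{x. x \<prec> z}| \<le>o lam"
proof (cases "z \<in> Field kappa")
  case True
  then show ?thesis
    using card_of_underS[OF kappa] by (simp add: ordLeq_lam_iff underS_rlt)
next
  case False
  then have "{x. x \<prec> z} = {}"
    using lt_Field by auto
  then show ?thesis
    using lam infinite_lam by (metis card_of_empty1 card_order_on_well_order_on)
qed

text \<open>Regularity: otherwise \<open>Z\<close> and the segments below its members, at most
  \<open>lam\<close> many of size at most \<open>lam\<close>, would cover
  \<open>kappa\<close>.\<close>

lemma bounded:
  assumes "Z \<subseteq> Field kappa" "|Z| \<le>o lam"
  shows "\<exists>u\<in>Field kappa. \<forall>z\<in>Z. z \<prec> u"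
proof (rule ccontr)
  assume "\<not> ?thesis"
  then have "Field kappa \<subseteq> Z \<union> (\<Union>z\<in>Z. {x. x \<prec> z})"
    using lt_linear assms(1) by blast
  moreover have "|Z \<union> (\<Union>z\<in>Z. {x. x \<prec> z})| \<le>o lam"
    by (rule card_of_Un_ordLeq_infinite_Field[OF infinite_lam assms(2) _ lam])
      (rule UNION_le_lam[OF assms(2) below_le_lam])
  ultimately have "|Field kappa| \<le>o lam"
    by (meson card_of_mono1 ordLeq_transitive)
  then have "|Field kappa| <o kappa" by (simp add: ordLeq_lam_iff)
  then show False
    using card_of_Field_ordIso[OF kappa] not_ordLess_ordIso by blast
qed

lemma image_bounded:
  assumes "|I| \<le>o lam" "f ` I \<subseteq> Field kappa"
  shows "\<exists>u\<in>Field kappa. \<forall>i\<in>I. f i \<prec> u"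
proof -
  have "|f ` I| \<le>o lam"
    using assms(1) card_of_image ordLeq_transitive by blast
  then show ?thesis using bounded[OF assms(2)] by blast
qed

lemma nat_le_lam: "|X :: nat set| \<le>o lam"
proof -
  have "|UNIV :: nat set| \<le>o |Field lam|"
    using infinite_lam by (simp add: infinite_iff_card_of_nat)
  then show ?thesis
    by (rule ordLeq_transitive[OF ordLeq_transitive[OF card_of_mono1[OF subset_UNIV]] lam_Field])
qed

lemma ex_greater:
  assumes "x \<in> Field kappa" "y \<in> Field kappa"
  obtains u where "u \<in> Field kappa" "x \<prec> u" "y \<prec> u"
proof -
  have "\<exists>u\<in>Field kappa. \<forall>i\<in>{0, 1 :: nat}. (if i = 0 then x else y) \<prec> u"
    by (rule image_bounded[OF nat_le_lam]) (use assms in auto)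
  then show thesis using that by (auto split: if_splits)
qed

text \<open>Failures \<open>f i\<close> for all \<open>i\<close> would have a common upper bound,
  and an index valid there is valid below it too.\<close>

lemma pigeonhole:
  assumes "\<And>u. u \<in> Field kappa \<Longrightarrow> \<exists>i\<in>Field lam. P i u"
    and "\<And>i u v. P i u \<Longrightarrow> v \<prec> u \<Longrightarrow> P i v"
  shows "\<exists>i\<in>Field lam. \<forall>u\<in>Field kappa. P i u"
proof (rule ccontr)
  assume "\<not> ?thesis"
  then obtain f where f: "\<And>i. i \<in> Field lam \<Longrightarrow> f i \<in> Field kappa \<and> \<not> P i (f i)"
    by metis
  then obtain u where "u \<in> Field kappa" "\<forall>i\<in>Field lam. f i \<prec> u"
    using image_bounded[OF lam_Field, of f] by blast
  then show False using assms f by blast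
qed

lemma surj_from_lam:
  assumes "|X| \<le>o lam"
  obtains f where "X \<subseteq> f ` Field lam"
proof (cases "X = {}")
  case False
  have "|X| \<le>o |Field lam|"
    using assms lam by (meson card_of_Field_ordIso ordIso_symmetric ordLeq_ordIso_trans)
  then obtain f where "f ` Field lam = X" using card_of_ordLeq2[OF False] by metis
  then show thesis using that by blast
qed (use that in blast)

text \<open>The values only have to include the predecessors of \<open>z\<close>;
  \<open>hull\<close> filters out stray values, and \<open>pr1_lift\<close> has a default for
  them.\<close>

definition enum :: "'b \<Rightarrow> 'a \<Rightarrow> 'b" where
  "enum z = (SOME f. {x. x \<prec> z} \<subseteq> f ` Field lam)"

lemma enum:
  assumes "x \<prec> z"
  shows "\<exists>i\<in>Field lam. enum z i = x"
proof -
  obtain f where "{x. x \<prec> z} \<subseteq> f ` Field lam"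
    by (rule surj_from_lam[OF below_le_lam])
  then have "{x. x \<prec> z} \<subseteq> enum z ` Field lam"
    unfolding enum_def by (rule someI[where P = "\<lambda>f. {x. x \<prec> z} \<subseteq> f ` Field lam"])
  then show ?thesis using assms by blast
qed

text \<open>The form of largeness used for thinning out; for disjoint families of nonempty subsets
  of \<open>kappa\<close> it amounts to size \<open>kappa\<close>.\<close>

definition unbounded_family :: "'b set set \<Rightarrow> bool" where
  "unbounded_family A \<longleftrightarrow> (\<forall>u\<in>Field kappa. \<exists>b\<in>A. \<forall>\<beta>\<in>b. u \<prec> \<beta>)"

text \<open>Otherwise every block has a point not above \<open>u\<close>; by disjointness these
  points are distinct, so there are at most \<open>lam\<close> blocks.\<close>

lemma disjoint_imp_unbounded:
  assumes "pairwise disjnt A" "\<And>b. b \<in> A \<Longrightarrow> b \<subseteq> Field kappa" "\<not> |A| \<le>o lam"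
  shows "unbounded_family A"
  unfolding unbounded_family_def
proof (rule ballI, rule ccontr)
  fix u assume u: "u \<in> Field kappa" and "\<not> (\<exists>b\<in>A. \<forall>\<beta>\<in>b. u \<prec> \<beta>)"
  then have "\<forall>b\<in>A. \<exists>\<beta>. \<beta> \<in> b \<and> \<not> u \<prec> \<beta>" by blast
  then obtain f where f: "\<And>b. b \<in> A \<Longrightarrow> f b \<in> b \<and> \<not> u \<prec> f b" by metis
  obtain v where v: "u \<prec> v" using ex_greater[OF u u] by blast
  have "f ` A \<subseteq> {x. x \<prec> v}"
    using f assms(2) v le_lt_trans by blast
  moreover have "inj_on f A"
    using f assms(1) unfolding inj_on_def pairwise_def disjnt_def by (metis disjoint_iff)
  ultimately have "|A| \<le>o |{x. x \<prec> v}|"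
    using card_of_ordLeq by blast
  then show False
    using below_le_lam assms(3) ordLeq_transitive by blast
qed

text \<open>Points chosen from at most \<open>lam\<close> blocks would be bounded. The empty block
  is excluded because it lies vacuously above every \<open>u\<close>.\<close>

lemma unbounded_imp_large:
  assumes "unbounded_family A" "\<And>b. b \<in> A \<Longrightarrow> b \<subseteq> Field kappa" "{} \<notin> A"
  shows "kappa \<le>o |A|"
proof -
  have "\<not> |A| <o kappa"
  proof
    assume "|A| <o kappa"
    then have "|A| \<le>o lam" by (simp add: ordLeq_lam_iff)
    moreover obtain f where f: "\<And>b. b \<in> A \<Longrightarrow> f b \<in> b"
      using assms(3) by (metis ex_in_conv)
    ultimately obtain u where "u \<in> Field kappa" "\<forall>b\<in>A. f b \<prec> u"
      using image_bounded[of A f] assms(2) by blast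
    then show False
      using assms(1) f lt_asym unfolding unbounded_family_def by blast
  qed
  then show ?thesis
    using wo_kappa not_ordLess_iff_ordLeq card_of_Well_order by blast
qed

text \<open>Clubs are represented by functions: this is a club if \<open>g\<close> maps
  \<open>kappa\<close> into itself.\<close>

definition closed_points :: "('b \<Rightarrow> 'b) \<Rightarrow> 'b set" where
  "closed_points g = {y \<in> Field kappa. \<forall>x. x \<prec> y \<longrightarrow> g x \<prec> y}"

text \<open>Take the least strict upper bound of an \<omega>-chain from \<open>u\<close>, each term
  exceeding the values of all \<open>g n\<close> below the previous term.\<close>

lemma closed_points_unbounded:
  assumes g: "\<And>n::nat. \<And>x. x \<in> Field kappa \<Longrightarrow> g n x \<in> Field kappa" and u: "u \<in> Field kappa"
  obtains y where "u \<prec> y" "\<And>n. y \<in> closed_points (g n)"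
proof -
  have "\<exists>v. x \<prec> v \<and> (\<forall>n z. z \<prec> x \<longrightarrow> g n z \<prec> v)" if x: "x \<in> Field kappa" for x
  proof -
    define X where "X = {x} \<union> (\<Union>n. g n ` {z. z \<prec> x})"
    have images: "|\<Union>n. g n ` {z. z \<prec> x}| \<le>o lam"
      by (rule UNION_le_lam[OF nat_le_lam]) (rule ordLeq_transitive[OF card_of_image below_le_lam])
    have "|X| \<le>o lam"
      unfolding X_def
    proof (rule card_of_Un_ordLeq_infinite_Field[OF infinite_lam _ images lam])
      have "Field lam \<noteq> {}" using infinite_lam by auto
      then show "|{x}| \<le>o lam"
        by (rule ordLeq_transitive[OF card_of_singl_ordLeq lam_Field])
    qed
    moreover have "X \<subseteq> Field kappa" unfolding X_def using x g lt_Field by blast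
    ultimately obtain v where "\<forall>z\<in>X. z \<prec> v" using bounded[of X] by blast
    then show ?thesis unfolding X_def by blast
  qed
  then obtain G where G: "\<And>x. x \<in> Field kappa \<Longrightarrow> x \<prec> G x"
    "\<And>x n z. x \<in> Field kappa \<Longrightarrow> z \<prec> x \<Longrightarrow> g n z \<prec> G x" by metis
  define s where "s k = (G ^^ k) u" for k
  have sF: "s k \<in> Field kappa" for k
    by (induction k) (use u lt_Field(2)[OF G(1)] in \<open>auto simp: s_def\<close>)
  have sS: "s k \<prec> s (Suc k)" for k
    using G(1)[OF sF[of k]] by (simp add: s_def)
  define S where "S = {y \<in> Field kappa. \<forall>k. s k \<prec> y}"
  have range: "range s \<subseteq> Field kappa" using sF by blast
  have ne: "S \<noteq> {}"
    using image_bounded[OF nat_le_lam range] by (auto simp: S_def)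
  have sub: "S \<subseteq> Field kappa" by (auto simp: S_def)
  obtain y where y: "y \<in> S" "\<forall>z\<in>S. \<not> z \<prec> y"
    using lt_least[OF sub ne] by blast
  have "g n x \<prec> y" if x: "x \<prec> y" for n x
  proof -
    obtain k where k: "\<not> s k \<prec> x" using y x lt_Field unfolding S_def by blast
    then have "x \<prec> s (Suc k)"
      using le_lt_trans sS lt_Field(1)[OF x] by blast
    then have "g n x \<prec> s (Suc (Suc k))"
      using G(2)[OF sF, of x "Suc k" n] by (simp add: s_def)
    then show ?thesis using y(1) lt_trans unfolding S_def by blast
  qed
  then have "y \<in> closed_points (g n)" for n
    using y(1) by (simp add: closed_points_def S_def)
  moreover have "u \<prec> y" using y(1) by (auto simp: S_def s_def dest: spec[of _ 0])
  ultimately show thesis using that by blast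
qed

section \<open>Decoding a bound, and the case of finite blocks\<close>

text \<open>\<open>D\<close> will be a bound of \<tau>. As \<open>i\<close> is below
  \<open>lam\<close> and common to all pairs of blocks, a color below \<open>lam\<close> can carry
  it.\<close>

definition decodes :: "('b set \<Rightarrow> bool) \<Rightarrow> ('b \<Rightarrow> 'b \<Rightarrow> 'a \<Rightarrow> 'b) \<Rightarrow> bool" where
  "decodes small H \<longleftrightarrow>
     (\<forall>A. \<forall>D\<in>Field kappa.
        unbounded_family A \<and> (\<forall>b\<in>A. b \<subseteq> Field kappa \<and> b \<noteq> {} \<and> small b) \<longrightarrow>
        (\<exists>i\<in>Field lam. \<exists>A'\<subseteq>A. unbounded_family A' \<and>
           (\<forall>a\<in>A'. \<forall>b\<in>A'. set_lt kappa a b \<longrightarrow> (\<forall>\<alpha>\<in>a. \<forall>\<beta>\<in>b. H \<alpha> \<beta> i = D))))"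

lemma decodes_mono:
  assumes "decodes small H" and small: "\<And>b. small' b \<Longrightarrow> small b"
  shows "decodes small' H"
  unfolding decodes_def
proof (intro allI ballI impI)
  fix A D
  assume D: "D \<in> Field kappa"
    and "unbounded_family A \<and> (\<forall>b\<in>A. b \<subseteq> Field kappa \<and> b \<noteq> {} \<and> small' b)"
  then have "unbounded_family A \<and> (\<forall>b\<in>A. b \<subseteq> Field kappa \<and> b \<noteq> {} \<and> small b)"
    using small by blast
  then show "\<exists>i\<in>Field lam. \<exists>A'\<subseteq>A. unbounded_family A' \<and>
      (\<forall>a\<in>A'. \<forall>b\<in>A'. set_lt kappa a b \<longrightarrow> (\<forall>\<alpha>\<in>a. \<forall>\<beta>\<in>b. H \<alpha> \<beta> i = D))"
    using assms(1)[unfolded decodes_def, rule_format, OF D] by blast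
qed

lemma inj_into_Pow_lam:
  obtains s :: "'b \<Rightarrow> 'a set" where "inj_on s (Field kappa)" "s ` Field kappa \<subseteq> Pow (Field lam)"
proof -
  have "lam <o |Pow (Field lam)|"
    using card_of_Pow[of "Field lam"] lam
    by (meson card_of_Field_ordIso ordIso_ordLess_trans ordIso_symmetric)
  then have "cardSuc lam \<le>o |Pow (Field lam)|"
    using cardSuc_least[OF lam card_of_Card_order] by blast
  then have "kappa \<le>o |Pow (Field lam)|"
    using kappa_succ ordIso_ordLeq_trans by blast
  then have "|Field kappa| \<le>o |Pow (Field lam)|"
    using card_of_Field_ordIso[OF kappa] ordIso_ordLeq_trans by blast
  then have "\<exists>s. inj_on s (Field kappa) \<and> s ` Field kappa \<subseteq> Pow (Field lam)"
    by (simp add: card_of_ordLeq)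
  then show thesis using that by blast
qed

lemma surj_codes:
  obtains dec :: "'a \<Rightarrow> 'a set \<times> ('a set \<times> 'a) set"
  where "Fpow (Field lam) \<times> Fpow (Fpow (Field lam) \<times> Field lam) \<subseteq> dec ` Field lam"
proof -
  let ?L = "Field lam"
  have Fpow: "|Fpow X| \<le>o lam" if "|X| \<le>o lam" for X :: "'x set"
  proof -
    have "lam \<le>o |?L|"
      using card_of_Field_ordIso[OF lam] ordIso_symmetric ordIso_imp_ordLeq by blast
    then have "|X| \<le>o |?L|"
      using that ordLeq_transitive by blast
    then show ?thesis
      using card_of_Fpow_ordLeq[OF infinite_lam] lam_Field ordLeq_transitive by blast
  qed
  have "|Fpow ?L \<times> Fpow (Fpow ?L \<times> ?L)| \<le>o lam"
    by (intro card_of_Times_ordLeq_infinite_Field[OF infinite_lam] Fpow lam_Field lam)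
  then show thesis
    by (rule surj_from_lam) (rule that)
qed

lemma surj_pairs:
  obtains dec :: "'a \<Rightarrow> 'a \<times> 'a" where "Field lam \<times> Field lam \<subseteq> dec ` Field lam"
proof -
  have "|Field lam \<times> Field lam| \<le>o lam"
    by (rule card_of_Times_ordLeq_infinite_Field[OF infinite_lam lam_Field lam_Field lam])
  then show thesis
    by (rule surj_from_lam) (rule that)
qed

lemma decodes_finite: "\<exists>H. decodes finite H"
proof -
  obtain s where s: "inj_on s (Field kappa)" "s ` Field kappa \<subseteq> Pow (Field lam)"
    by (rule inj_into_Pow_lam)
  obtain dec where dec:
    "Fpow (Field lam) \<times> Fpow (Fpow (Field lam) \<times> Field lam) \<subseteq> dec ` Field lam"
    by (rule surj_codes)
  \<comment> \<open>\<open>dec i\<close> is a finite set with a finite table: the trace of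
    \<open>s \<beta>\<close> on the set is looked up in the table, giving a position in the
    enumeration of \<beta>.\<close>
  define H where "H = (\<lambda>(\<alpha>::'b) \<beta> i.
     enum \<beta> (SOME j. (s \<beta> \<inter> fst (dec i), j) \<in> snd (dec i)))"
  have "\<exists>i\<in>Field lam. \<exists>A'\<subseteq>A. unbounded_family A' \<and>
           (\<forall>a\<in>A'. \<forall>b\<in>A'. set_lt kappa a b \<longrightarrow> (\<forall>\<alpha>\<in>a. \<forall>\<beta>\<in>b. H \<alpha> \<beta> i = D))"
    if D: "D \<in> Field kappa" and A: "unbounded_family A"
      and fin: "\<And>b. b \<in> A \<Longrightarrow> b \<subseteq> Field kappa \<and> finite b" for A D
  proof -
    have code: "\<exists>i\<in>Field lam. \<forall>\<alpha>. \<forall>\<beta>\<in>b. H \<alpha> \<beta> i = D" if b: "b \<in> A" "\<forall>\<beta>\<in>b. D \<prec> \<beta>" for b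
    proof -
      have "inj_on s b" using s(1) fin[OF b(1)] inj_on_subset by blast
      then obtain F where F: "finite F" "F \<subseteq> \<Union> (s ` b)" "inj_on (\<lambda>\<beta>. s \<beta> \<inter> F) b"
        using finite_separating_set fin[OF b(1)] by metis
      obtain j where j: "\<And>\<beta>. \<beta> \<in> b \<Longrightarrow> j \<beta> \<in> Field lam \<and> enum \<beta> (j \<beta>) = D"
        using b(2) enum by metis
      have FL: "F \<subseteq> Field lam" using F(2) s(2) fin[OF b(1)] by blast
      define \<phi> where "\<phi> = (\<lambda>\<beta>. (s \<beta> \<inter> F, j \<beta>)) ` b"
      have "F \<in> Fpow (Field lam)" using FL F(1) by (simp add: Fpow_def)
      moreover have "\<phi> \<in> Fpow (Fpow (Field lam) \<times> Field lam)"
        using FL F(1) j fin[OF b(1)] unfolding \<phi>_def Fpow_def by auto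
      ultimately obtain i where i: "i \<in> Field lam" "dec i = (F, \<phi>)"
        using dec by (metis (no_types, lifting) SigmaI imageE subsetD)
      have "H \<alpha> \<beta> i = D" if "\<beta> \<in> b" for \<alpha> \<beta>
      proof -
        \<comment> \<open>The traces on \<open>F\<close> are distinct, so the table is single-valued
          and \<open>SOME\<close> returns the intended position.\<close>
        have "(s \<beta> \<inter> F, j') \<in> \<phi> \<longleftrightarrow> j' = j \<beta>" for j'
          using that F(3) unfolding \<phi>_def inj_on_def by auto
        then show ?thesis
          using j[OF that] by (simp add: H_def i(2))
      qed
      then show ?thesis using i(1) by blast
    qed
    define P where
      "P i u \<longleftrightarrow> (\<exists>b\<in>A. (\<forall>\<beta>\<in>b. u \<prec> \<beta>) \<and> (\<forall>\<alpha>. \<forall>\<beta>\<in>b. H \<alpha> \<beta> i = D))" for i u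
    have "\<exists>i\<in>Field lam. P i u" if uF: "u \<in> Field kappa" for u
    proof -
      obtain v where v: "v \<in> Field kappa" "u \<prec> v" "D \<prec> v"
        by (rule ex_greater[OF uF D])
      then obtain b where b: "b \<in> A" "\<forall>\<beta>\<in>b. v \<prec> \<beta>"
        using A unfolding unbounded_family_def by blast
      then have u: "\<forall>\<beta>\<in>b. u \<prec> \<beta>" and "\<forall>\<beta>\<in>b. D \<prec> \<beta>"
        using v lt_trans by blast+
      then show ?thesis
        using code[OF b(1)] b(1) unfolding P_def by blast
    qed
    moreover have "P i v" if "P i u" "v \<prec> u" for i u v
      using that lt_trans[OF that(2)] unfolding P_def by blast
    ultimately have "\<exists>i\<in>Field lam. \<forall>u\<in>Field kappa. P i u"
      by (rule pigeonhole)
    then obtain i where i: "i \<in> Field lam" "\<forall>u\<in>Field kappa. P i u" by blast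
    define A' where "A' = {b \<in> A. \<forall>\<alpha>. \<forall>\<beta>\<in>b. H \<alpha> \<beta> i = D}"
    have "unbounded_family A'"
      unfolding unbounded_family_def A'_def using i(2)[unfolded P_def] by blast
    moreover have "A' \<subseteq> A" "\<forall>b\<in>A'. \<forall>\<alpha>. \<forall>\<beta>\<in>b. H \<alpha> \<beta> i = D"
      by (auto simp: A'_def)
    ultimately show ?thesis using i(1) by blast
  qed
  then have "decodes finite H"
    unfolding decodes_def by (intro allI ballI impI) metis
  then show ?thesis by blast
qed

end

section \<open>Uncountable cofinality: closing off under ladders and escapes\<close>

locale succ_card_uncountable_cof = succ_card lam kappa
  for lam :: "'a rel" and kappa :: "'b rel" +
  assumes no_countable_cofinal: "\<And>s :: nat \<Rightarrow> 'a. \<not> cofinal lam (range s)"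
begin

abbreviation Seg :: "'a \<Rightarrow> 'a set" where "Seg \<equiv> underS lam"

lemma trans_lam: "trans lam" and antisym_lam: "antisym lam"
  using wo_lam by (simp_all add: order_on_defs)

lemmas Seg_mono = underS_incr[OF trans_lam antisym_lam]
  and lam_le_trans = transD[OF trans_lam]

lemma lam_max:
  assumes "i \<in> Field lam" "j \<in> Field lam"
  obtains k where "k \<in> Field lam" "(i, k) \<in> lam" "(j, k) \<in> lam"
proof (cases "rlt lam i j")
  case True
  then show thesis
    using that[of j] assms in_iff_not_rlt[OF wo_lam] rlt_asym[OF wo_lam] by simp
next
  case False
  then show thesis
    using that[of i] assms in_iff_not_rlt[OF wo_lam] by simp
qed

text \<open>\<open>lam\<close> is uncountable, or its field would be a countable cofinal set. So
  \<omega> and \<open>X\<close> both fit into proper initial segments, and \<open>k\<close> is taken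
  beyond these and \<open>i\<close>.\<close>

lemma ex_index:
  assumes i: "i \<in> Field lam" and X: "|X| <o lam"
  obtains k where "k \<in> Field lam" "(i, k) \<in> lam" "\<not> finite (Seg k)" "|X| \<le>o |Seg k|"
proof -
  have "|UNIV :: nat set| <o lam"
  proof (rule ccontr)
    assume "\<not> ?thesis"
    then have "lam \<le>o |UNIV :: nat set|"
      using wo_lam not_ordLess_iff_ordLeq card_of_Well_order by blast
    then have "|Field lam| \<le>o |UNIV :: nat set|"
      using lam_Field ordLeq_transitive by blast
    moreover have "Field lam \<noteq> {}" using infinite_lam by auto
    ultimately have "\<exists>s :: nat \<Rightarrow> 'a. range s = Field lam"
      by (simp add: card_of_ordLeq2)
    then obtain s :: "nat \<Rightarrow> 'a" where s: "range s = Field lam" by blast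
    then have "cofinal lam (range s)"
      using cofinal_Field[OF wo_lam] by simp
    then show False using no_countable_cofinal by blast
  qed
  then obtain m where m: "m \<in> Field lam" "|UNIV :: nat set| \<le>o |Seg m|"
    by (rule ordLess_card_underS[OF lam])
  obtain n where n: "n \<in> Field lam" "|X| \<le>o |Seg n|"
    by (rule ordLess_card_underS[OF lam X])
  obtain l where l: "l \<in> Field lam" "(i, l) \<in> lam" "(m, l) \<in> lam"
    by (rule lam_max[OF i m(1)])
  obtain k where k: "k \<in> Field lam" "(l, k) \<in> lam" "(n, k) \<in> lam"
    by (rule lam_max[OF l(1) n(1)])
  have "\<not> finite (Seg m)" using m(2) by (simp add: infinite_iff_card_of_nat)
  moreover have "Seg m \<subseteq> Seg k"
    by (rule Seg_mono[OF lam_le_trans[OF l(3) k(2)]])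
  ultimately have "\<not> finite (Seg k)"
    using finite_subset by metis
  moreover have "|X| \<le>o |Seg k|"
    by (rule ordLeq_transitive[OF n(2) card_of_mono1[OF Seg_mono[OF k(3)]]])
  ultimately show thesis by (rule that[OF k(1) lam_le_trans[OF l(2) k(2)]])
qed

definition cofinal_below :: "'b \<Rightarrow> 'b set \<Rightarrow> bool" where
  "cofinal_below z c \<longleftrightarrow> c \<subseteq> {x. x \<prec> z} \<and> (\<forall>x. x \<prec> z \<longrightarrow> (\<exists>v\<in>c. \<not> v \<prec> x))"

text \<open>The cofinality of \<open>z\<close> is at most the cardinality of
  \<open>Seg i\<close>.\<close>

definition short :: "'a \<Rightarrow> 'b \<Rightarrow> bool" where
  "short i z \<longleftrightarrow> (\<exists>c. cofinal_below z c \<and> |c| \<le>o |Seg i| )"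

definition ladder :: "'a \<Rightarrow> 'b \<Rightarrow> 'b set" where
  "ladder i z = (SOME c. cofinal_below z c \<and> |c| \<le>o |Seg i| )"

lemma ladder:
  assumes "short i z"
  shows "cofinal_below z (ladder i z)" "|ladder i z| \<le>o |Seg i|"
proof -
  have "cofinal_below z (ladder i z) \<and> |ladder i z| \<le>o |Seg i|"
    unfolding ladder_def by (rule someI_ex[OF assms[unfolded short_def]])
  then show "cofinal_below z (ladder i z)" "|ladder i z| \<le>o |Seg i|" by simp_all
qed

lemma not_short_bounded:
  assumes "\<not> short i x" "|Q| \<le>o |Seg i|"
  shows "\<exists>u. u \<prec> x \<and> (\<forall>v\<in>Q. v \<prec> x \<longrightarrow> v \<prec> u)"
proof -
  have "|Q \<inter> {v. v \<prec> x}| \<le>o |Seg i|"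
    by (rule ordLeq_transitive[OF card_of_mono1 assms(2)]) blast
  then have "\<not> cofinal_below x (Q \<inter> {v. v \<prec> x})"
    using assms(1) unfolding short_def by blast
  then show ?thesis unfolding cofinal_below_def by blast
qed

definition escape :: "('b \<Rightarrow> 'b) \<Rightarrow> 'b \<Rightarrow> 'b" where
  "escape g z = (SOME x. x \<prec> z \<and> \<not> g x \<prec> z)"

lemma escape:
  assumes "z \<in> Field kappa" "z \<notin> closed_points g"
  shows "escape g z \<prec> z" "\<not> g (escape g z) \<prec> z"
proof -
  have "\<exists>x. x \<prec> z \<and> \<not> g x \<prec> z" using assms by (auto simp: closed_points_def)
  from someI_ex[OF this] show "escape g z \<prec> z" "\<not> g (escape g z) \<prec> z"
    unfolding escape_def by blast+
qed

text \<open>Designed so that a set closed under steps cannot have a gap just below \<open>x\<close>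
  that contains a point of all clubs of \<open>G\<close>, unless \<open>x\<close> is in these clubs
  and not short.\<close>

definition step :: "'a \<Rightarrow> ('b \<Rightarrow> 'b) set \<Rightarrow> 'b rel" where
  "step i G = {(z, v). short i z \<and> v \<in> ladder i z} \<union>
     {(z, v). \<exists>g\<in>G. z \<in> Field kappa \<and> z \<notin> closed_points g \<and> v = escape g z}"

definition reach :: "'a \<Rightarrow> ('b \<Rightarrow> 'b) set \<Rightarrow> 'b \<Rightarrow> 'b set" where
  "reach i G d = (step i G)\<^sup>* `` {d}"

lemma step_decreasing:
  assumes "(z, v) \<in> step i G"
  shows "v \<prec> z"
proof (cases "short i z \<and> v \<in> ladder i z")
  case True
  then show ?thesis using ladder(1)[of i z] by (auto simp: cofinal_below_def)
next
  case False
  then show ?thesis using assms escape(1) by (auto simp: step_def)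
qed

lemma reach_self: "d \<in> reach i G d"
  by (simp add: reach_def)

lemma reach_step: "x \<in> reach i G d \<Longrightarrow> (x, v) \<in> step i G \<Longrightarrow> v \<in> reach i G d"
  by (simp add: reach_def)

lemma reach_mono: "G \<subseteq> G' \<Longrightarrow> reach i G d \<subseteq> reach i G' d"
  unfolding reach_def by (rule Image_mono[OF rtrancl_mono]) (auto simp: step_def)

lemma reach_le:
  assumes "x \<in> reach i G d"
  shows "x = d \<or> x \<prec> d"
proof -
  have "(d, x) \<in> (step i G)\<^sup>*" using assms by (simp add: reach_def)
  then show ?thesis
  proof (induction rule: rtrancl_induct)
    case (step y z)
    then show ?case using step_decreasing[OF step(2)] lt_trans[of z y d] by auto
  qed simp
qed

text \<open>A point has at most |Seg i| ladder steps and finitely many escapes; the infinite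
  \<open>Seg i\<close> absorbs the iteration.\<close>

lemma card_reach:
  assumes "\<not> finite (Seg i)" "finite G"
  shows "|reach i G d| \<le>o |Seg i|"
  unfolding reach_def
proof (rule card_of_rtrancl_Image_ordLeq[OF assms(1)])
  fix z
  have *: "step i G `` {z} \<subseteq> (if short i z then ladder i z else {}) \<union> (\<lambda>g. escape g z) ` G"
    unfolding step_def by auto
  have "\<not> finite (Field |Seg i| )" using assms(1) by (simp add: Field_card_of)
  moreover have "|if short i z then ladder i z else {}| \<le>o |Seg i|"
    using ladder(2) card_of_empty by auto
  moreover have "|(\<lambda>g. escape g z) ` G| \<le>o |Seg i|"
    using assms by (meson card_of_ordLeq_finite card_of_Well_order finite_imageI
        ordLeq_total)
  ultimately have
    "|(if short i z then ladder i z else {}) \<union> (\<lambda>g. escape g z) ` G| \<le>o |Seg i|"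
    by (rule card_of_Un_ordLeq_infinite_Field) (rule card_of_Card_order)
  then show "|step i G `` {z}| \<le>o |Seg i|"
    using card_of_mono1[OF *] ordLeq_transitive by blast
qed

text \<open>
A closed point \<open>y\<close> of \<open>g\<close> below \<open>x\<close> cannot lie above \<open>escape g x\<close>, as \<open>g\<close> would map that below \<open>y\<close>.
\<close>

lemma step_not_below:
  assumes "y \<prec> x" and "short i x \<or> (\<exists>g\<in>G. y \<in> closed_points g \<and> x \<notin> closed_points g)"
  obtains v where "(x, v) \<in> step i G" "\<not> v \<prec> y"
proof (cases "short i x")
  case True
  then obtain v where "v \<in> ladder i x" "\<not> v \<prec> y"
    using ladder(1) assms(1) unfolding cofinal_below_def by blast
  then show thesis using True that unfolding step_def by blast
next
  case False
  then obtain g where g: "g \<in> G" "y \<in> closed_points g" "x \<notin> closed_points g"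
    using assms(2) by blast
  have xF: "x \<in> Field kappa" using assms(1) lt_Field by blast
  have "\<not> escape g x \<prec> y"
    using g(2) escape(2)[OF xF g(3)] assms(1) lt_trans unfolding closed_points_def by blast
  then show thesis using that g xF unfolding step_def by blast
qed

section \<open>Guessing clubs from finitely many clubs\<close>

abbreviation regs :: "('b \<Rightarrow> 'b) set" where "regs \<equiv> {g. g ` Field kappa \<subseteq> Field kappa}"

text \<open>A form of club guessing: a closure built from \<open>G\<close> alone meets the club of
  \<open>g\<close>. Arbitrarily large \<open>i\<close> are asked for, since \<open>i\<close> must
  later exceed the positions of \<open>d\<close> in the enumerations of a whole block.\<close>

definition guesses :: "('b \<Rightarrow> 'b) set \<Rightarrow> ('b \<Rightarrow> 'b) \<Rightarrow> bool" where
  "guesses G g \<longleftrightarrow> (\<exists>d\<in>Field kappa. \<forall>i0\<in>Field lam. \<exists>i. (i0, i) \<in> lam \<and> \<not> finite (Seg i) \<and>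
     (\<exists>x\<in>reach i G d. x \<in> closed_points g \<and> \<not> short i x))"

text \<open>\<open>E\<close> has more than \<open>lam\<close> members, so \<open>lam\<close> of them
  lie below some \<open>d\<close>; a proper initial segment of the cardinal \<open>lam\<close> is
  smaller.\<close>

lemma ex_large_initial_part:
  assumes "\<And>u. u \<in> Field kappa \<Longrightarrow> \<exists>y\<in>E. u \<prec> y" "E \<subseteq> Field kappa"
  obtains d where "d \<in> Field kappa" "\<And>i. i \<in> Field lam \<Longrightarrow> \<not> |{y \<in> E. y \<prec> d}| \<le>o |Seg i|"
proof -
  have "\<not> |E| \<le>o lam"
    using bounded[OF assms(2)] assms lt_asym by blast
  then have "lam \<le>o |E|"
    using ordLeq_total wo_lam card_of_Well_order by blast
  then have "|Field lam| \<le>o |E|"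
    using lam_Field ordLeq_transitive by blast
  then have "\<exists>f. inj_on f (Field lam) \<and> f ` Field lam \<subseteq> E"
    by (simp add: card_of_ordLeq)
  then obtain f where f: "inj_on f (Field lam)" "f ` Field lam \<subseteq> E" by blast
  then have "f ` Field lam \<subseteq> Field kappa" using assms(2) by blast
  then obtain d where d: "d \<in> Field kappa" "\<forall>i\<in>Field lam. f i \<prec> d"
    using image_bounded[OF lam_Field] by blast
  have "|Field lam| \<le>o |{y \<in> E. y \<prec> d}|"
    using card_of_ordLeq[of "Field lam" "{y \<in> E. y \<prec> d}"] f d(2) by blast
  then have large: "lam \<le>o |{y \<in> E. y \<prec> d}|"
    using card_of_Field_ordIso[OF lam] ordIso_symmetric ordIso_ordLeq_trans by blast
  have "\<not> |{y \<in> E. y \<prec> d}| \<le>o |Seg i|" if "i \<in> Field lam" for i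
  proof
    assume "|{y \<in> E. y \<prec> d}| \<le>o |Seg i|"
    then have "lam \<le>o |Seg i|" using large ordLeq_transitive by blast
    then show False
      using card_of_underS[OF lam that] not_ordLess_ordLeq by blast
  qed
  then show thesis using that d(1) by blast
qed

text \<open>
Otherwise choose successive counterexamples \<open>g\<^sub>0, g\<^sub>1, \<dots>\<close>, each defeating the set of its predecessors.
The closed points of all of them outnumber the union of the countably many hulls, so some such \<open>y\<close> is
outside it, and the least member \<open>x\<close> of the union above \<open>y\<close> admits no step to below itself:
it is not short and is closed under every \<open>g\<^sub>n\<close>. Since \<open>x\<close> appears at a finite stage \<open>n\<close>,
it contradicts the choice of \<open>g\<^sub>n\<close>. An index \<open>i\<close> serving all stages exists because \<open>cf \<lambda> > \<omega>\<close>.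
\<close>

lemma ex_guessing: "\<exists>G. finite G \<and> (\<forall>g\<in>regs. guesses G g)"
proof (rule ccontr)
  assume "\<not> ?thesis"
  then obtain B where B: "\<And>G. finite G \<Longrightarrow> B G \<in> regs \<and> \<not> guesses G (B G)" by metis
  define Gs where "Gs n = ((\<lambda>X. insert (B X) X) ^^ n) {}" for n
  have Gs_Suc: "Gs (Suc n) = insert (B (Gs n)) (Gs n)" for n by (simp add: Gs_def)
  have fin: "finite (Gs n)" for n
    by (induction n) (simp_all add: Gs_Suc, simp add: Gs_def)
  have mono: "Gs m \<subseteq> Gs n" if "m \<le> n" for m n
    using that by (rule lift_Suc_mono_le[rotated]) (auto simp: Gs_Suc)
  define g where "g n = B (Gs n)" for n
  have gF: "g n x \<in> Field kappa" if "x \<in> Field kappa" for n x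
    using B[OF fin] that unfolding g_def by blast
  have not_guess: "\<not> guesses (Gs n) (g n)" for n
    using B[OF fin] unfolding g_def by blast
  define E where "E = {y \<in> Field kappa. \<forall>n. y \<in> closed_points (g n)}"
  have E_unbounded: "\<exists>y\<in>E. u \<prec> y" if u: "u \<in> Field kappa" for u
  proof -
    obtain y where "u \<prec> y" "\<And>n. y \<in> closed_points (g n)"
      using closed_points_unbounded[of g, OF gF u] by metis
    then show ?thesis using lt_Field(2) by (auto simp: E_def)
  qed
  have "E \<subseteq> Field kappa" by (auto simp: E_def)
  from ex_large_initial_part[OF E_unbounded this] obtain d where d: "d \<in> Field kappa"
    "\<And>i. i \<in> Field lam \<Longrightarrow> \<not> |{y \<in> E. y \<prec> d}| \<le>o |Seg i|"
    by metis
  have "\<exists>i0\<in>Field lam. \<forall>i. (i0, i) \<in> lam \<and> \<not> finite (Seg i) \<longrightarrow>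
      (\<forall>x\<in>reach i (Gs n) d. x \<in> closed_points (g n) \<longrightarrow> short i x)" for n
    using not_guess[of n] d(1) unfolding guesses_def by blast
  then obtain i0 where i0: "\<And>n. i0 n \<in> Field lam"
    "\<And>n i x. (i0 n, i) \<in> lam \<Longrightarrow> \<not> finite (Seg i) \<Longrightarrow> x \<in> reach i (Gs n) d \<Longrightarrow>
       x \<in> closed_points (g n) \<Longrightarrow> short i x"
    by metis
  have "range i0 \<subseteq> Field lam" using i0(1) by blast
  then obtain i1 where i1: "i1 \<in> Field lam" "\<forall>n. rlt lam (i0 n) i1"
    using not_cofinal_bound[OF wo_lam _ no_countable_cofinal, of i0] by blast
  \<comment> \<open>Only an infinite segment beyond \<open>i1\<close> is wanted, so
    \<open>ex_index\<close> is applied to the empty set.\<close>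
  have "|{} :: 'a set| <o lam"
    using card_of_underS[OF lam i1(1)] card_of_empty ordLeq_ordLess_trans by blast
  then obtain i where i: "i \<in> Field lam" "(i1, i) \<in> lam" "\<not> finite (Seg i)"
    using ex_index[OF i1(1)] by metis
  have i0_le: "(i0 n, i) \<in> lam" for n
    using i1(2) i(2) lam_le_trans unfolding rlt_def by blast
  define R where "R = (\<Union>n. reach i (Gs n) d)"
  have "|R| \<le>o |Seg i|"
    unfolding R_def by (rule card_of_nat_UNION_ordLeq[OF i(3) card_reach[OF i(3) fin]])
  then have "\<not> {y \<in> E. y \<prec> d} \<subseteq> R"
    using d(2)[OF i(1)] card_of_mono1 ordLeq_transitive by blast
  then obtain y where y: "y \<in> E" "y \<prec> d" "y \<notin> R" by blast
  have R_Field: "R \<subseteq> Field kappa"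
    unfolding R_def using reach_le lt_Field(1) d(1) by blast
  have "{z \<in> R. y \<prec> z} \<noteq> {}"
    using y(2) reach_self unfolding R_def by blast
  then obtain x where x: "x \<in> R" "y \<prec> x" "\<forall>z\<in>R. y \<prec> z \<longrightarrow> \<not> z \<prec> x"
    using lt_least[of "{z \<in> R. y \<prec> z}"] R_Field by blast
  obtain n where n: "x \<in> reach i (Gs n) d" using x(1) unfolding R_def by blast
  have no_step: "\<not> v \<in> R" if "v \<prec> x" "\<not> v \<prec> y" for v
    using x(3) that y(1,3) lt_linear[of v y] lt_Field(1)[OF that(1)] lt_Field(1)[OF y(2)] by blast
  have stuck: "\<not> (short i x \<or> (\<exists>h\<in>Gs N. y \<in> closed_points h \<and> x \<notin> closed_points h))"
    if N: "n \<le> N" for N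
  proof
    assume "short i x \<or> (\<exists>h\<in>Gs N. y \<in> closed_points h \<and> x \<notin> closed_points h)"
    then obtain v where v: "(x, v) \<in> step i (Gs N)" "\<not> v \<prec> y"
      by (rule step_not_below[OF x(2)])
    have "x \<in> reach i (Gs N) d" using n reach_mono[OF mono[OF N]] by blast
    then have "v \<in> R" using reach_step[OF _ v(1)] unfolding R_def by blast
    then show False using no_step step_decreasing[OF v(1)] v(2) by blast
  qed
  \<comment> \<open>\<open>g n\<close> enters only at stage n + 1, so \<open>stuck\<close> at n + 1
    puts \<open>x\<close> into its club; \<open>i0\<close> then makes \<open>x\<close> short,
    against \<open>stuck\<close> at n.\<close>
  have "g n \<in> Gs (Suc n)" by (simp add: g_def Gs_Suc)
  moreover have "y \<in> closed_points (g n)" using y(1) by (simp add: E_def)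
  ultimately have "x \<in> closed_points (g n)" using stuck[of "Suc n"] by auto
  then have "short i x" by (rule i0(2)[OF i0_le i(3) n])
  then show False using stuck[of n] by simp
qed

definition guess :: "('b \<Rightarrow> 'b) set" where
  "guess = (SOME G. finite G \<and> (\<forall>g\<in>regs. guesses G g))"

lemma guess: "finite guess" "g ` Field kappa \<subseteq> Field kappa \<Longrightarrow> guesses guess g"
proof -
  have *: "finite guess \<and> (\<forall>g\<in>regs. guesses guess g)"
    unfolding guess_def by (rule someI_ex[OF ex_guessing])
  then show "finite guess" by simp
  show "g ` Field kappa \<subseteq> Field kappa \<Longrightarrow> guesses guess g"
    using * by simp
qed

section \<open>Hulls, their isolated points, and decoding\<close>

text \<open>Once \<open>i\<close> is beyond a position of \<open>d\<close> in
  \<open>enum \<beta>\<close>, the hull contains all that is reachable from \<open>d\<close>; this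
  lets one \<open>d\<close> serve a whole block.\<close>

definition hull :: "'b \<Rightarrow> 'a \<Rightarrow> 'b set" where
  "hull \<beta> i = (\<Union>d\<in>{d \<in> enum \<beta> ` Seg i. d \<prec> \<beta>}. reach i guess d)"

lemma hull_Field: "hull \<beta> i \<subseteq> Field kappa"
proof
  fix x assume "x \<in> hull \<beta> i"
  then obtain d where "d \<prec> \<beta>" "x \<in> reach i guess d" by (auto simp: hull_def)
  then show "x \<in> Field kappa" using reach_le[of x i guess d] lt_Field(1) by auto
qed

lemma card_hull:
  assumes "\<not> finite (Seg i)"
  shows "|hull \<beta> i| \<le>o |Seg i|"
  unfolding hull_def
proof (rule card_of_UNION_ordLeq_infinite[OF assms])
  show "|{d \<in> enum \<beta> ` Seg i. d \<prec> \<beta>}| \<le>o |Seg i|"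
    by (rule ordLeq_transitive[OF card_of_mono1 card_of_image]) blast
qed (use card_reach[OF assms guess(1)] in blast)

text \<open>Smaller than the cofinality of \<open>lam\<close>: the first part lets a segment absorb
  the block, the second bounds positions attached to its members.\<close>

definition below_cof :: "'b set \<Rightarrow> bool" where
  "below_cof b \<longleftrightarrow> |b| <o lam \<and> (\<forall>f. f ` b \<subseteq> Field lam \<longrightarrow> \<not> cofinal lam (f ` b))"

text \<open>
This is Fodor's argument: if the bounds failed for every \<open>(\<epsilon>, i)\<close>, a point closed under the function
bounding the failures would refute itself.
\<close>

lemma anchors:
  assumes A: "unbounded_family A" and small: "\<And>b. b \<in> A \<Longrightarrow> below_cof b"
  shows "\<exists>\<epsilon>\<in>Field kappa. \<exists>i\<in>Field lam. \<forall>u\<in>Field kappa. \<exists>x. \<exists>b\<in>A. u \<prec> x \<and>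
    (\<forall>\<beta>\<in>b. x \<prec> \<beta> \<and> x \<in> hull \<beta> i \<and> (\<forall>v\<in>hull \<beta> i. v \<prec> x \<longrightarrow> \<not> \<epsilon> \<prec> v))"
proof (rule ccontr)
  define P where "P \<epsilon> i x b \<longleftrightarrow>
    (\<forall>\<beta>\<in>b. x \<prec> \<beta> \<and> x \<in> hull \<beta> i \<and> (\<forall>v\<in>hull \<beta> i. v \<prec> x \<longrightarrow> \<not> \<epsilon> \<prec> v))" for \<epsilon> i x b
  assume "\<not> ?thesis"
  then have "\<not> (\<exists>\<epsilon>\<in>Field kappa. \<exists>i\<in>Field lam. \<forall>u\<in>Field kappa.
      \<exists>x. \<exists>b\<in>A. u \<prec> x \<and> P \<epsilon> i x b)"
    unfolding P_def .
  then obtain h where h: "\<And>\<epsilon> i. \<epsilon> \<in> Field kappa \<Longrightarrow> i \<in> Field lam \<Longrightarrow> h \<epsilon> i \<in> Field kappa"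
    "\<And>\<epsilon> i x b. \<epsilon> \<in> Field kappa \<Longrightarrow> i \<in> Field lam \<Longrightarrow> b \<in> A \<Longrightarrow> h \<epsilon> i \<prec> x \<Longrightarrow> \<not> P \<epsilon> i x b"
    by metis
  have "\<exists>u\<in>Field kappa. \<forall>i\<in>Field lam. h \<epsilon> i \<prec> u" if "\<epsilon> \<in> Field kappa" for \<epsilon>
    by (rule image_bounded[OF lam_Field]) (use h(1)[OF that] in blast)
  then obtain g where g: "\<And>\<epsilon>. \<epsilon> \<in> Field kappa \<Longrightarrow> g \<epsilon> \<in> Field kappa"
    "\<And>\<epsilon> i. \<epsilon> \<in> Field kappa \<Longrightarrow> i \<in> Field lam \<Longrightarrow> h \<epsilon> i \<prec> g \<epsilon>"
    by metis
  have "guesses guess g" using g(1) by (intro guess(2)) blast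
  then obtain d where d: "d \<in> Field kappa"
    "\<And>i0. i0 \<in> Field lam \<Longrightarrow> \<exists>i. (i0, i) \<in> lam \<and> \<not> finite (Seg i) \<and>
     (\<exists>x\<in>reach i guess d. x \<in> closed_points g \<and> \<not> short i x)"
    unfolding guesses_def by blast
  obtain b where b: "b \<in> A" "\<forall>\<beta>\<in>b. d \<prec> \<beta>"
    using A d(1) unfolding unbounded_family_def by blast
  obtain k where k: "\<And>\<beta>. \<beta> \<in> b \<Longrightarrow> k \<beta> \<in> Field lam \<and> enum \<beta> (k \<beta>) = d"
    using b(2) enum by metis
  have kb: "k ` b \<subseteq> Field lam" using k by blast
  then have "\<not> cofinal lam (k ` b)"
    using small[OF b(1)] unfolding below_cof_def by blast
  \<comment> \<open>Beyond \<open>i1\<close> all hulls contain \<open>d\<close>, beyond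
    \<open>i2\<close> segments absorb the block; guessing then gives \<open>i\<close> beyond
    both.\<close>
  then obtain i1 where i1: "i1 \<in> Field lam" "\<forall>\<beta>\<in>b. rlt lam (k \<beta>) i1"
    using not_cofinal_bound[OF wo_lam kb] by blast
  have "|b| <o lam" using small[OF b(1)] unfolding below_cof_def by blast
  then obtain i2 where i2: "i2 \<in> Field lam" "(i1, i2) \<in> lam" "|b| \<le>o |Seg i2|"
    using ex_index[OF i1(1)] by metis
  obtain i x where i: "(i2, i) \<in> lam" "\<not> finite (Seg i)"
    and x: "x \<in> reach i guess d" "x \<in> closed_points g" "\<not> short i x"
    using d(2)[OF i2(1)] by blast
  have iF: "i \<in> Field lam" using i(1) by (auto simp: Field_def)
  have in_hull: "x \<in> hull \<beta> i" if "\<beta> \<in> b" for \<beta>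
  proof -
    have "k \<beta> \<in> Seg i1" using i1(2) that by (simp add: underS_rlt)
    then have "k \<beta> \<in> Seg i"
      using Seg_mono[OF lam_le_trans[OF i2(2) i(1)]] by blast
    then have "d \<in> enum \<beta> ` Seg i" using k[OF that] by blast
    then show ?thesis using x(1) b(2) that unfolding hull_def by blast
  qed
  have above: "x \<prec> \<beta>" if "\<beta> \<in> b" for \<beta>
    using reach_le[OF x(1)] b(2) that lt_trans by blast
  have "|b| \<le>o |Seg i|"
    by (rule ordLeq_transitive[OF i2(3) card_of_mono1[OF Seg_mono[OF i(1)]]])
  then have "|\<Union>\<beta>\<in>b. hull \<beta> i| \<le>o |Seg i|"
    by (rule card_of_UNION_ordLeq_infinite[OF i(2)]) (use card_hull[OF i(2)] in blast)
  then obtain \<epsilon> where \<epsilon>: "\<epsilon> \<prec> x" "\<forall>v\<in>\<Union>\<beta>\<in>b. hull \<beta> i. v \<prec> x \<longrightarrow> v \<prec> \<epsilon>"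
    using not_short_bounded[OF x(3)] by blast
  have \<epsilon>F: "\<epsilon> \<in> Field kappa" using lt_Field(1)[OF \<epsilon>(1)] .
  have "P \<epsilon> i x b"
    unfolding P_def using in_hull above \<epsilon>(2) lt_asym by blast
  moreover have "h \<epsilon> i \<prec> x"
  proof (rule lt_trans[OF g(2)[OF \<epsilon>F iF]])
    show "g \<epsilon> \<prec> x" using x(2) \<epsilon>(1) unfolding closed_points_def by blast
  qed
  ultimately show False using h(2)[OF \<epsilon>F iF b(1)] by blast
qed

definition next_in_hull :: "'b \<Rightarrow> 'b \<Rightarrow> 'a \<Rightarrow> 'b" where
  "next_in_hull \<alpha> \<beta> i =
     (THE x. x \<in> hull \<beta> i \<and> \<alpha> \<prec> x \<and> (\<forall>v\<in>hull \<beta> i. \<alpha> \<prec> v \<longrightarrow> \<not> v \<prec> x))"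

text \<open>A hull member between \<alpha> and \<open>x\<close> would lie between \<epsilon> and
  \<open>x\<close>, where the hull has no points.\<close>

lemma next_in_hull_eq:
  assumes x: "x \<in> hull \<beta> i" "\<forall>v\<in>hull \<beta> i. v \<prec> x \<longrightarrow> \<not> \<epsilon> \<prec> v" and "\<epsilon> \<prec> \<alpha>" "\<alpha> \<prec> x"
  shows "next_in_hull \<alpha> \<beta> i = x"
  unfolding next_in_hull_def
proof (rule the_equality)
  show *: "x \<in> hull \<beta> i \<and> \<alpha> \<prec> x \<and> (\<forall>v\<in>hull \<beta> i. \<alpha> \<prec> v \<longrightarrow> \<not> v \<prec> x)"
    using assms lt_trans[OF assms(3)] by blast
  fix y assume y: "y \<in> hull \<beta> i \<and> \<alpha> \<prec> y \<and> (\<forall>v\<in>hull \<beta> i. \<alpha> \<prec> v \<longrightarrow> \<not> v \<prec> y)"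
  then have "\<not> x \<prec> y" "\<not> y \<prec> x" using * by blast+
  then show "y = x" using lt_linear[of x y] hull_Field x(1) y by blast
qed

lemma decodes_below_cof: "\<exists>H. decodes below_cof H"
proof -
  obtain dec where dec: "Field lam \<times> Field lam \<subseteq> dec ` Field lam"
    by (rule surj_pairs)
  define H where "H = (\<lambda>\<alpha> \<beta> k. enum (next_in_hull \<alpha> \<beta> (fst (dec k))) (snd (dec k)))"
  have "\<exists>i\<in>Field lam. \<exists>A'\<subseteq>A. unbounded_family A' \<and>
           (\<forall>a\<in>A'. \<forall>b\<in>A'. set_lt kappa a b \<longrightarrow> (\<forall>\<alpha>\<in>a. \<forall>\<beta>\<in>b. H \<alpha> \<beta> i = D))"
    if D: "D \<in> Field kappa" and A: "unbounded_family A"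
      and blocks: "\<And>b. b \<in> A \<Longrightarrow> b \<subseteq> Field kappa \<and> b \<noteq> {} \<and> below_cof b" for A D
  proof -
    have "\<exists>\<epsilon>\<in>Field kappa. \<exists>i\<in>Field lam. \<forall>u\<in>Field kappa. \<exists>x. \<exists>b\<in>A. u \<prec> x \<and>
        (\<forall>\<beta>\<in>b. x \<prec> \<beta> \<and> x \<in> hull \<beta> i \<and> (\<forall>v\<in>hull \<beta> i. v \<prec> x \<longrightarrow> \<not> \<epsilon> \<prec> v))"
      by (rule anchors[OF A]) (use blocks in blast)
    then obtain \<epsilon> i xs bs where \<epsilon>: "\<epsilon> \<in> Field kappa" and i: "i \<in> Field lam"
      and bs: "\<And>u. u \<in> Field kappa \<Longrightarrow> bs u \<in> A"
      and xs: "\<And>u. u \<in> Field kappa \<Longrightarrow> u \<prec> xs u"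
        "\<And>u \<beta>. u \<in> Field kappa \<Longrightarrow> \<beta> \<in> bs u \<Longrightarrow> xs u \<prec> \<beta> \<and> xs u \<in> hull \<beta> i \<and>
          (\<forall>v\<in>hull \<beta> i. v \<prec> xs u \<longrightarrow> \<not> \<epsilon> \<prec> v)"
      by metis
    have "\<exists>w\<in>Field kappa. \<forall>\<beta>\<in>bs u. \<beta> \<prec> w" if "u \<in> Field kappa" for u
    proof (rule bounded)
      show "bs u \<subseteq> Field kappa" using blocks bs that by blast
      show "|bs u| \<le>o lam"
        using blocks bs that ordLess_imp_ordLeq unfolding below_cof_def by blast
    qed
    then obtain B where B: "\<And>u. u \<in> Field kappa \<Longrightarrow> B u \<in> Field kappa"
      "\<And>u \<beta>. u \<in> Field kappa \<Longrightarrow> \<beta> \<in> bs u \<Longrightarrow> \<beta> \<prec> B u"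
      by metis
    \<comment> \<open>\<open>B\<close> bounds the blocks, so closure under \<open>B\<close> puts the
      blocks of smaller indices below \<open>y\<close>; the members of \<open>bs y\<close> exceed
      \<open>y\<close>, hence \<epsilon>; and \<open>D\<close> has the common position
      \<open>j\<close> in the enumeration of \<open>xs y\<close>.\<close>
    define ok where
      "ok j y \<longleftrightarrow> y \<in> closed_points B \<and> \<epsilon> \<prec> y \<and> D \<prec> y \<and> enum (xs y) j = D" for j y
    define P where "P j u \<longleftrightarrow> (\<exists>y. u \<prec> y \<and> ok j y)" for j u
    have "\<exists>j\<in>Field lam. P j u" if u: "u \<in> Field kappa" for u
    proof -
      obtain v where v: "v \<in> Field kappa" "u \<prec> v" "D \<prec> v"
        by (rule ex_greater[OF u D])
      obtain w where w: "w \<in> Field kappa" "v \<prec> w" "\<epsilon> \<prec> w"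
        by (rule ex_greater[OF v(1) \<epsilon>])
      obtain y where y: "w \<prec> y" "y \<in> closed_points B"
        using closed_points_unbounded[of "\<lambda>_. B", OF B(1) w(1)] by blast
      have "D \<prec> y" "u \<prec> y" "\<epsilon> \<prec> y"
        using v w y(1) lt_trans by blast+
      moreover have "D \<prec> xs y"
        using lt_trans[OF \<open>D \<prec> y\<close> xs(1)] lt_Field(2)[OF y(1)] by blast
      then obtain j where "j \<in> Field lam" "enum (xs y) j = D" using enum by blast
      ultimately show ?thesis using y(2) unfolding P_def ok_def by blast
    qed
    moreover have "P j v" if "P j u" "v \<prec> u" for j u v
      using that(1) lt_trans[OF that(2)] unfolding P_def by blast
    ultimately have "\<exists>j\<in>Field lam. \<forall>u\<in>Field kappa. P j u"
      by (rule pigeonhole)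
    then obtain j where j: "j \<in> Field lam" "\<forall>u\<in>Field kappa. P j u" by blast
    have "(i, j) \<in> dec ` Field lam" using dec i j(1) by blast
    then obtain k where k: "k \<in> Field lam" "dec k = (i, j)" by (metis imageE)
    have okF: "y \<in> Field kappa" if "ok j y" for y
      using that unfolding ok_def closed_points_def by blast
    define A' where "A' = bs ` {y. ok j y}"
    have "unbounded_family A'"
      unfolding unbounded_family_def
    proof
      fix u assume "u \<in> Field kappa"
      then obtain y where y: "u \<prec> y" "ok j y" using j(2) unfolding P_def by blast
      have "u \<prec> \<beta>" if "\<beta> \<in> bs y" for \<beta>
        using lt_trans[OF lt_trans[OF y(1) xs(1)[OF okF[OF y(2)]]]] xs(2)[OF okF[OF y(2)] that]
        by blast
      then show "\<exists>b\<in>A'. \<forall>\<beta>\<in>b. u \<prec> \<beta>" using y(2) unfolding A'_def by blast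
    qed
    moreover have "A' \<subseteq> A" unfolding A'_def using okF bs by blast
    moreover have "H \<alpha> \<beta> k = D"
      if asm: "a \<in> A'" "b \<in> A'" "set_lt kappa a b" "\<alpha> \<in> a" "\<beta> \<in> b" for a b \<alpha> \<beta>
    proof -
      obtain z y where z: "a = bs z" "ok j z" and y: "b = bs y" "ok j y"
        using asm(1,2) unfolding A'_def by blast
      note zF = okF[OF z(2)] and yF = okF[OF y(2)]
      have "\<alpha> \<prec> \<beta>" using asm(3-5) unfolding set_lt_def by blast
      have \<alpha>: "z \<prec> \<alpha>" "\<alpha> \<prec> B z"
        using lt_trans[OF xs(1)[OF zF]] xs(2)[OF zF] B(2)[OF zF] asm(4) z(1) by blast+
      have \<beta>: "y \<prec> \<beta>" "\<beta> \<prec> B y" "xs y \<in> hull \<beta> i"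
        "\<forall>v\<in>hull \<beta> i. v \<prec> xs y \<longrightarrow> \<not> \<epsilon> \<prec> v"
        using lt_trans[OF xs(1)[OF yF]] xs(2)[OF yF] B(2)[OF yF] asm(5) y(1) by blast+
      \<comment> \<open>If \<open>y\<close> came first, closure under \<open>B\<close> would put its
        block below \<open>z\<close>, against \<alpha> being below \<beta>.\<close>
      have "\<not> y \<prec> z"
      proof
        assume "y \<prec> z"
        then have "B y \<prec> z" using z(2) unfolding ok_def closed_points_def by blast
        then have "\<beta> \<prec> \<alpha>" using \<beta>(2) \<alpha>(1) lt_trans by blast
        then show False using \<open>\<alpha> \<prec> \<beta>\<close> lt_asym by blast
      qed
      moreover have "z \<noteq> y"
      proof
        assume "z = y"
        then have "a = b" using z(1) y(1) by simp
        then have "\<alpha> \<prec> \<alpha>" using asm(3,4) unfolding set_lt_def by blast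
        then show False by simp
      qed
      ultimately have "z \<prec> y" using lt_linear[OF zF yF] by blast
      then have "B z \<prec> y" using y(2) unfolding ok_def closed_points_def by blast
      then have "\<alpha> \<prec> xs y" using \<alpha>(2) xs(1)[OF yF] lt_trans by blast
      moreover have "\<epsilon> \<prec> \<alpha>" using \<alpha>(1) z(2) lt_trans unfolding ok_def by blast
      ultimately have "next_in_hull \<alpha> \<beta> i = xs y"
        by (intro next_in_hull_eq[OF \<beta>(3,4)])
      then show ?thesis
        using y(2) unfolding H_def k(2) ok_def by simp
    qed
    ultimately show ?thesis using k(1) by blast
  qed
  then have "decodes below_cof H"
    unfolding decodes_def by (intro allI ballI impI) metis
  then show ?thesis by blast
qed

end

section \<open>Passing between \<open>lam\<close> and \<open>kappa\<close> colors\<close>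

context succ_card
begin

text \<open>A countable cofinal set makes \<open>chi\<close> at most \<omega>, so blocks are finite;
  otherwise no block smaller than \<open>chi\<close> maps cofinally into \<open>lam\<close>.\<close>

lemma ex_decoding:
  fixes chi :: "'c rel"
  assumes chi: "le_cf chi lam"
  shows "\<exists>H. decodes (\<lambda>b. |b| <o chi) H"
proof (cases "\<exists>s :: nat \<Rightarrow> 'a. cofinal lam (range s)")
  case True
  then obtain s :: "nat \<Rightarrow> 'a" where s: "cofinal lam (range s)" by blast
  have "chi \<le>o |range s|" using chi s unfolding le_cf_def by blast
  then have chi_le: "chi \<le>o |UNIV :: nat set|"
    using card_of_image ordLeq_transitive by blast
  have "finite b" if "|b| <o chi" for b :: "'b set"
  proof (rule ccontr)
    assume "infinite b"
    then have "|UNIV :: nat set| \<le>o |b|" by (simp add: infinite_iff_card_of_nat)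
    then have "chi \<le>o |b|" using chi_le ordLeq_transitive by blast
    then show False using that not_ordLess_ordLeq by blast
  qed
  then have "decodes (\<lambda>b. |b| <o chi) H" if "decodes finite H" for H
    by (rule decodes_mono[OF that])
  then show ?thesis using decodes_finite by blast
next
  case False
  interpret succ_card_uncountable_cof lam kappa
    by unfold_locales (use False in blast)
  have "below_cof b" if b: "|b| <o chi" for b
    unfolding below_cof_def
  proof (intro conjI allI impI)
    have "cofinal lam (Field lam)" by (rule cofinal_Field[OF wo_lam])
    then have "chi \<le>o |Field lam|" using chi unfolding le_cf_def by blast
    then have "|b| <o |Field lam|" by (rule ordLess_ordLeq_trans[OF b])
    then show "|b| <o lam" by (rule ordLess_ordLeq_trans[OF _ lam_Field])
    fix f
    show "\<not> cofinal lam (f ` b)"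
    proof
      assume "cofinal lam (f ` b)"
      then have "chi \<le>o |f ` b|" using chi unfolding le_cf_def by blast
      then have "chi \<le>o |b|" using card_of_image ordLeq_transitive by blast
      then show False using b not_ordLess_ordLeq by blast
    qed
  qed
  then have "decodes (\<lambda>b. |b| <o chi) H" if "decodes below_cof H" for H
    by (rule decodes_mono[OF that])
  then show ?thesis using decodes_below_cof by blast
qed

lemma card_of_block:
  assumes "b \<subseteq> Field kappa" "Restr kappa b =o sigma" "sigma <o chi"
  shows "|b| <o chi"
proof -
  have "Field (Restr kappa b) = b"
  proof -
    have "(x, x) \<in> kappa" if "x \<in> b" for x
      using in_iff_not_rlt[OF wo_kappa, of x x] assms(1) that by auto
    then show ?thesis by (auto simp: Field_def)
  qed
  then have "well_order_on b (Restr kappa b)"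
    using Well_order_Restr[OF wo_kappa, of b] by simp
  then have "|b| \<le>o Restr kappa b" by (rule card_of_least)
  then show ?thesis
    using assms(2,3) ordLeq_ordIso_trans ordLeq_ordLess_trans by blast
qed

text \<open>For order type zero: a family with an empty block consists of that block alone and is
  not large.\<close>

lemma Restr_ordIso_empty:
  assumes "b \<subseteq> Field kappa" "Restr kappa b =o sigma" "Restr kappa {} =o sigma"
  shows "b = {}"
proof -
  have "Restr kappa b =o Restr kappa {}"
    using assms(2,3) ordIso_symmetric ordIso_transitive by blast
  then have "Field (Restr kappa b) = {}"
    by (auto simp: ordIso_def iso_def bij_betw_def)
  moreover have "(x, x) \<in> kappa" if "x \<in> b" for x
    using in_iff_not_rlt[OF wo_kappa, of x x] assms(1) that by auto
  ultimately show ?thesis by (auto simp: Field_def)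
qed

lemma pr1_lift:
  fixes chi :: "'c rel"
  assumes H: "decodes (\<lambda>b. |b| <o chi) H" and p: "is_pair_fun kappa (Field lam) p"
    and wit: "pr1_wit kappa lam chi lam p c"
  shows "pr1 kappa kappa chi lam p"
proof -
  obtain dec where dec: "Field lam \<times> Field lam \<subseteq> dec ` Field lam"
    by (rule surj_pairs)
  \<comment> \<open>The old color codes \<open>i\<close> and a position: \<open>i\<close> makes
    \<open>H\<close> return \<open>D\<close>, and the position selects the wanted color in the
    enumeration of \<open>D\<close>.\<close>
  define val where
    "val \<alpha> \<beta> = enum (H \<alpha> \<beta> (fst (dec (c \<alpha> \<beta>)))) (snd (dec (c \<alpha> \<beta>)))" for \<alpha> \<beta>
  \<comment> \<open>The default keeps \<open>c'\<close> inside \<open>kappa\<close>; where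
    \<open>val\<close> equals a value of \<tau> it does not apply.\<close>
  define c' where "c' \<alpha> \<beta> = (if val \<alpha> \<beta> \<in> Field kappa then val \<alpha> \<beta> else \<alpha>)" for \<alpha> \<beta>
  have "pr1_wit kappa kappa chi lam p c'"
    unfolding pr1_wit_def
  proof (intro conjI allI impI)
    show "is_pair_fun kappa (Field kappa) c'"
      unfolding is_pair_fun_def c'_def by simp
    fix sigma :: "'c rel" and A :: "'b set set" and \<tau> :: "'a \<Rightarrow> 'b"
    assume sigma: "Well_order sigma \<and> sigma <o chi"
      and "(\<forall>a\<in>A. a \<subseteq> Field kappa \<and> Restr kappa a =o sigma) \<and>
          pairwise disjnt A \<and> |A| =o kappa"
      and \<tau>: "\<forall>i\<in>Field lam. \<tau> i \<in> Field kappa"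
    then have A: "\<And>a. a \<in> A \<Longrightarrow> a \<subseteq> Field kappa" "\<And>a. a \<in> A \<Longrightarrow> Restr kappa a =o sigma"
      "pairwise disjnt A" "|A| =o kappa" by blast+
    have large: "\<not> |A| \<le>o lam"
      using A(4) not_ordLess_ordIso by (auto simp: ordLeq_lam_iff)
    have nonempty: "{} \<notin> A"
    proof
      assume "{} \<in> A"
      then have "A \<subseteq> {{}}" using Restr_ordIso_empty A(1,2) by blast
      moreover have "|{{}} :: 'b set set| \<le>o |Field lam|"
        by (rule card_of_singl_ordLeq) (use infinite_lam in auto)
      ultimately show False
        using large lam_Field card_of_mono1 ordLeq_transitive by metis
    qed
    have blocks: "\<forall>b\<in>A. b \<subseteq> Field kappa \<and> b \<noteq> {} \<and> |b| <o chi"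
      using A(1,2) nonempty card_of_block sigma by metis
    have "\<tau> ` Field lam \<subseteq> Field kappa" using \<tau> by blast
    from image_bounded[OF lam_Field this] obtain D where
      D: "D \<in> Field kappa" "\<forall>i\<in>Field lam. \<tau> i \<prec> D" by blast
    have "\<forall>\<xi>\<in>Field lam. \<exists>i\<in>Field lam. enum D i = \<tau> \<xi>"
      using D(2) enum by simp
    then obtain j where j: "\<And>\<xi>. \<xi> \<in> Field lam \<Longrightarrow> j \<xi> \<in> Field lam \<and> enum D (j \<xi>) = \<tau> \<xi>"
      by metis
    have "unbounded_family A" by (rule disjoint_imp_unbounded[OF A(3,1) large])
    then have "unbounded_family A \<and> (\<forall>b\<in>A. b \<subseteq> Field kappa \<and> b \<noteq> {} \<and> |b| <o chi)"
      using blocks by simp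
    from H[unfolded decodes_def, THEN spec, THEN bspec, OF D(1), THEN mp, OF this]
    obtain i A' where i: "i \<in> Field lam" and A': "A' \<subseteq> A" "unbounded_family A'"
      and HD: "\<forall>a\<in>A'. \<forall>b\<in>A'. set_lt kappa a b \<longrightarrow> (\<forall>\<alpha>\<in>a. \<forall>\<beta>\<in>b. H \<alpha> \<beta> i = D)"
      by blast
    have "\<exists>k\<in>Field lam. dec k = (i, j \<xi>)" if "\<xi> \<in> Field lam" for \<xi>
    proof -
      have "(i, j \<xi>) \<in> dec ` Field lam" using dec i j[OF that] by blast
      then show ?thesis by (metis imageE)
    qed
    then obtain code where code: "\<And>\<xi>. \<xi> \<in> Field lam \<Longrightarrow> code \<xi> \<in> Field lam \<and> dec (code \<xi>) = (i, j \<xi>)"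
      by metis
    \<comment> \<open>The old coloring is applied to the thinned family, which must again have size
      \<open>kappa\<close>, with the codes as targets.\<close>
    have "kappa \<le>o |A'|"
      by (rule unbounded_imp_large[OF A'(2)]) (use A'(1) A(1) nonempty in blast)+
    moreover have "|A'| \<le>o kappa"
      by (rule ordLeq_ordIso_trans[OF card_of_mono1[OF A'(1)] A(4)])
    ultimately have "|A'| =o kappa" by (simp add: ordIso_iff_ordLeq)
    moreover have "pairwise disjnt A'" by (rule pairwise_subset[OF A(3) A'(1)])
    ultimately have blocks': "(\<forall>a\<in>A'. a \<subseteq> Field kappa \<and> Restr kappa a =o sigma) \<and>
        pairwise disjnt A' \<and> |A'| =o kappa"
      using A(1,2) A'(1) by blast
    have codes: "\<forall>\<xi>\<in>Field lam. code \<xi> \<in> Field lam" using code by blast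
    from wit[unfolded pr1_wit_def, THEN conjunct2, THEN spec, THEN mp, OF sigma,
        THEN spec, THEN mp, OF blocks', THEN spec, THEN mp, OF codes]
    obtain a b where ab: "a \<in> A'" "b \<in> A'" "set_lt kappa a b"
      and cab: "\<forall>x\<in>a. \<forall>y\<in>b. c x y = code (p x y)"
      by blast
    have "c' x y = \<tau> (p x y)" if "x \<in> a" "y \<in> b" for x y
    proof -
      have xy: "x \<prec> y" using ab(3) that unfolding set_lt_def by blast
      then have pxy: "p x y \<in> Field lam" using p lt_Field unfolding is_pair_fun_def by blast
      have "H x y i = D" using HD ab that by blast
      then have "val x y = \<tau> (p x y)"
        unfolding val_def using cab that code[OF pxy] j[OF pxy] by simp
      then show ?thesis using \<tau> pxy by (simp add: c'_def)
    qed
    then show "\<exists>a\<in>A. \<exists>b\<in>A. set_lt kappa a b \<and> (\<forall>x\<in>a. \<forall>y\<in>b. c' x y = \<tau> (p x y))"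
      using ab A'(1) by blast
  qed
  then show ?thesis unfolding pr1_def by blast
qed

lemma pr1_restrict_colors:
  assumes p: "is_pair_fun kappa (Field lam) p" and wit: "pr1_wit kappa kappa chi lam p c"
  shows "pr1 kappa lam chi lam p"
proof -
  have "lam \<le>o kappa"
    using cardSuc_ordLeq[OF lam] kappa_succ ordIso_symmetric ordLeq_ordIso_trans by blast
  then have "|Field lam| \<le>o kappa" using lam_Field ordLeq_transitive by blast
  then have "|Field lam| \<le>o |Field kappa|"
    using card_of_Field_ordIso[OF kappa] ordIso_symmetric ordLeq_ordIso_trans by blast
  then have "\<exists>e. inj_on e (Field lam) \<and> e ` Field lam \<subseteq> Field kappa"
    by (simp add: card_of_ordLeq)
  then obtain e where e: "inj_on e (Field lam)" "e ` Field lam \<subseteq> Field kappa" by blast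
  obtain l where l: "l \<in> Field lam" using infinite_lam by fastforce
  \<comment> \<open>Colors outside the range of \<open>e\<close> become \<open>l\<close>; the
    targets used below are all in that range.\<close>
  define c' where
    "c' x y = (if c x y \<in> e ` Field lam then inv_into (Field lam) e (c x y) else l)" for x y
  have "pr1_wit kappa lam chi lam p c'"
    unfolding pr1_wit_def
  proof (intro conjI allI impI)
    show "is_pair_fun kappa (Field lam) c'"
      unfolding is_pair_fun_def c'_def using l by (auto intro: inv_into_into)
    fix sigma :: "'c rel" and A :: "'b set set" and \<tau> :: "'a \<Rightarrow> 'a"
    assume sigma: "Well_order sigma \<and> sigma <o chi"
      and A: "(\<forall>a\<in>A. a \<subseteq> Field kappa \<and> Restr kappa a =o sigma) \<and>
          pairwise disjnt A \<and> |A| =o kappa"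
      and \<tau>: "\<forall>i\<in>Field lam. \<tau> i \<in> Field lam"
    have colors: "\<forall>i\<in>Field lam. (e \<circ> \<tau>) i \<in> Field kappa" using \<tau> e(2) by auto
    from wit[unfolded pr1_wit_def, THEN conjunct2, THEN spec, THEN mp, OF sigma,
        THEN spec, THEN mp, OF A, THEN spec, THEN mp, OF colors]
    obtain a b where ab: "a \<in> A" "b \<in> A" "set_lt kappa a b"
      and cab: "\<forall>x\<in>a. \<forall>y\<in>b. c x y = (e \<circ> \<tau>) (p x y)"
      by blast
    have "c' x y = \<tau> (p x y)" if "x \<in> a" "y \<in> b" for x y
    proof -
      have "x \<prec> y" using ab(3) that unfolding set_lt_def by blast
      then have "p x y \<in> Field lam" using p lt_Field unfolding is_pair_fun_def by blast
      then show ?thesis using cab that \<tau> e(1) by (simp add: c'_def)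
    qed
    then show "\<exists>a\<in>A. \<exists>b\<in>A. set_lt kappa a b \<and> (\<forall>x\<in>a. \<forall>y\<in>b. c' x y = \<tau> (p x y))"
      using ab by blast
  qed
  then show ?thesis unfolding pr1_def by blast
qed

end

theorem theoremA:
  fixes lam :: "'a rel" and kappa :: "'b rel" and chi :: "'c rel"
    and p :: "'b \<Rightarrow> 'b \<Rightarrow> 'a"
  assumes "Card_order lam" and "\<not> finite (Field lam)"
    and "Card_order kappa" and "(kappa, cardSuc lam) \<in> ordIso"
    and "is_pair_fun kappa (Field lam) p"
    and "Card_order chi" and "le_cf chi lam"
  shows "pr1 kappa lam chi lam p \<longleftrightarrow> pr1 kappa kappa chi lam p"
proof -
  interpret succ_card lam kappa
    by unfold_locales (fact assms)+
  obtain H where "decodes (\<lambda>b. |b| <o chi) H"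
    using ex_decoding[OF assms(7)] by blast
  then show ?thesis
    using pr1_lift[OF _ assms(5)] pr1_restrict_colors[OF assms(5)] unfolding pr1_def by metis
qed

end
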